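(* Let $X$ be a finite regular q-cycle set such that $|X|>1$. Then $X$ is simple if and only if $\mathcal{G}(X)$ acts transitively on $X$ and, for every non-trivial imprimitive blocks system $\{\Delta_x\}_{x\in X}$ of $\mathcal{G}(X)$, there exists $u\in X$ such that $\mathrm{Dis}(X,\Delta_u)\nleq\mathrm{Fix}(\{\Delta_x\}_{x\in X})$.
   Context: A q-cycle set is a non-empty set $X$ with two binary operations $\cdot$ and $:$ such that for every $x\in X$ the map $\sigma_x:X\to X$, $y\mapsto x\cdot y$ is bijective, and for all $x,y,z\in X$: $(x\cdot y)\cdot(x\cdot z)=(y:x)\cdot(y\cdot z)$, $(x:y):(x:z)=(y\cdot x):(y:z)$, and $(x\cdot y):(x\cdot z)=(y:x)\cdot(y:z)$. It is regular if $\delta_x:X\to X$, $y\mapsto x:y$ is bijective for every $x\in X$. Its permutation group is $\mathcal{G}(X)=\langle\sigma_x,\delta_x\mid x\in X\rangle\le\mathrm{Sym}_X$. A regular q-cycle set $X$ with $|X|>1$ is simple if, for every epimorphism (surjective homomorphism) $f:X\to Y$ of q-cycle sets, either $f$ is an isomorphism or $|Y|=1$. All q-cycle sets are finite. Let $G$ be a finite group acting transitively on $X$. A block is a subset $\Delta\subsetneq X$ with at least two elements such that, for each $g\in G$, $g(\Delta)=\Delta$ or $g(\Delta)\cap\Delta=\emptyset$. The partition $\{g(\Delta)\}_{g\in G}$ of $X$ is then a (non-trivial) imprimitive blocks system; it is written $\{\Delta_x\}_{x\in X}$, where $\Delta_x$ is the member of the system containing $x$ (so $g(\Delta_x)=\Delta_{g(x)}$).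 For a blocks system $\mathcal{B}$, $\mathrm{Fix}(\mathcal{B})=\bigcap_{\Delta\in\mathcal{B}}G_\Delta$, where $G_\Delta=\{g\in G\mid g(\Delta)=\Delta\}$; here $G=\mathcal{G}(X)$. For a block $\Delta$ of $\mathcal{G}(X)$, $\mathrm{Dis}(X,\Delta):=\langle\sigma_x^{-1}\sigma_y,\ \delta_x^{-1}\delta_y\mid x,y\in\Delta\rangle$.
   Formalization: The formal theorem additionally excludes the q-cycle set with |X| = 2 and x·y = x:y = y for all x, y: it is regular and simple, but its permutation group is trivial and so not transitive, which makes the statement false for it. *)

theory Defs
  imports "HOL-Algebra.Group_Action" "HOL-Algebra.Generated_Groups"
begin

text \<open>The infix \<open>\<Ztypecolon>\<close> stands for the operation usually written with a colon.\<close>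

locale q_cycle_set =
  fixes X :: "'a set"
    and dot :: "'a \<Rightarrow> 'a \<Rightarrow> 'a" (infixl "\<cdot>" 70)
    and col :: "'a \<Rightarrow> 'a \<Rightarrow> 'a" (infixl "\<Ztypecolon>" 70)
  assumes nonempty: "X \<noteq> {}"
    and col_closed: "\<lbrakk>x \<in> X; y \<in> X\<rbrakk> \<Longrightarrow> x \<Ztypecolon> y \<in> X"
    and dot_bij: "x \<in> X \<Longrightarrow> bij_betw (\<lambda>y. x \<cdot> y) X X"
    and dot_dot: "\<lbrakk>x \<in> X; y \<in> X; z \<in> X\<rbrakk> \<Longrightarrow>
      (x \<cdot> y) \<cdot> (x \<cdot> z) = (y \<Ztypecolon> x) \<cdot> (y \<cdot> z)"
    and col_col: "\<lbrakk>x \<in> X; y \<in> X; z \<in> X\<rbrakk> \<Longrightarrow>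
      (x \<Ztypecolon> y) \<Ztypecolon> (x \<Ztypecolon> z) = (y \<cdot> x) \<Ztypecolon> (y \<Ztypecolon> z)"
    and dot_col: "\<lbrakk>x \<in> X; y \<in> X; z \<in> X\<rbrakk> \<Longrightarrow>
      (x \<cdot> y) \<Ztypecolon> (x \<cdot> z) = (y \<Ztypecolon> x) \<cdot> (y \<Ztypecolon> z)"

locale regular_q_cycle_set = q_cycle_set +
  assumes col_bij: "x \<in> X \<Longrightarrow> bij_betw (\<lambda>y. x \<Ztypecolon> y) X X"

definition q_cycle_epi ::
  "'a set \<Rightarrow> ('a \<Rightarrow> 'a \<Rightarrow> 'a) \<Rightarrow> ('a \<Rightarrow> 'a \<Rightarrow> 'a) \<Rightarrow>
   'b set \<Rightarrow> ('b \<Rightarrow> 'b \<Rightarrow> 'b) \<Rightarrow> ('b \<Rightarrow> 'b \<Rightarrow> 'b) \<Rightarrow> ('a \<Rightarrow> 'b) \<Rightarrow> bool"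
  where "q_cycle_epi X dot col Y dot' col' f \<longleftrightarrow>
    f ` X = Y \<and>
    (\<forall>x\<in>X. \<forall>y\<in>X. f (dot x y) = dot' (f x) (f y) \<and> f (col x y) = col' (f x) (f y))"

text \<open>An isomorphism is a bijective homomorphism.  The targets \<open>Y\<close> are taken inside the type of
  \<open>X\<close>; this is no restriction, see \<open>simple_q_cycle_set_any_type\<close> below.\<close>

definition simple_q_cycle_set ::
  "'a set \<Rightarrow> ('a \<Rightarrow> 'a \<Rightarrow> 'a) \<Rightarrow> ('a \<Rightarrow> 'a \<Rightarrow> 'a) \<Rightarrow> bool"
  where "simple_q_cycle_set X dot col \<longleftrightarrow>
    regular_q_cycle_set X dot col \<and> finite X \<and> card X > 1 \<and>
    (\<forall>(Y :: 'a set) dot' col' f.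
       q_cycle_set Y dot' col' \<and> q_cycle_epi X dot col Y dot' col' f \<longrightarrow>
       bij_betw f X Y \<or> card Y = 1)"

lemma simple_q_cycle_set_any_type:
  fixes Y :: "'b set"
  assumes simple: "simple_q_cycle_set X dot col"
    and Y: "q_cycle_set Y dot' col'"
    and epi: "q_cycle_epi X dot col Y dot' col' f"
  shows "bij_betw f X Y \<or> card Y = 1"
proof -
  interpret Y: q_cycle_set Y dot' col' by (rule Y)
  have fX: "f ` X = Y" using epi by (simp add: q_cycle_epi_def)
  define g where "g = inv_into X f"
  have fg: "f (g y) = y" if "y \<in> Y" for y
    using that fX by (simp add: g_def f_inv_into_f)
  have inj: "inj_on g Y" by (metis fg inj_onI)
  define d where "d = (\<lambda>a b. g (dot' (f a) (f b)))"
  define c where "c = (\<lambda>a b. g (col' (f a) (f b)))"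
  have dY: "dot' y z \<in> Y" if "y \<in> Y" "z \<in> Y" for y z
    using Y.dot_bij[OF that(1)] that(2) by (auto simp: bij_betw_def)
  have bij: "bij_betw (\<lambda>b. d (g y) b) (g ` Y) (g ` Y)" if "y \<in> Y" for y
  proof -
    have "bij_betw f (g ` Y) Y"
      using fg by (auto simp: bij_betw_def inj_on_def image_image)
    moreover have "bij_betw g Y (g ` Y)"
      using inj by (simp add: bij_betw_def)
    ultimately have "bij_betw (g \<circ> (\<lambda>z. dot' y z) \<circ> f) (g ` Y) (g ` Y)"
      using Y.dot_bij[OF that] bij_betw_trans by metis
    then show ?thesis using that by (simp add: d_def fg comp_def)
  qed
  have "q_cycle_set (g ` Y) d c"
  proof
    show "g ` Y \<noteq> {}" using Y.nonempty by simp
  qed (auto simp: bij, auto simp: d_def c_def fg dY Y.col_closed Y.dot_dot Y.col_col Y.dot_col)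
  moreover have "q_cycle_epi X dot col (g ` Y) d c (g \<circ> f)"
    using epi fX by (auto simp: q_cycle_epi_def d_def c_def fg)
  ultimately have "bij_betw (g \<circ> f) X (g ` Y) \<or> card (g ` Y) = 1"
    using simple unfolding simple_q_cycle_set_def by blast
  then show ?thesis
  proof
    assume "bij_betw (g \<circ> f) X (g ` Y)"
    then have "inj_on f X" by (metis bij_betw_def inj_on_imageI2)
    then show ?thesis using fX by (simp add: bij_betw_def)
  next
    assume "card (g ` Y) = 1"
    then show ?thesis using card_image[OF inj] by simp
  qed
qed

text \<open>Left translations \<open>y \<mapsto> op x y\<close> as elements of \<open>BijGroup X\<close>, which consists of extensional
  functions: \<open>\<sigma>\<^sub>x\<close> is \<open>ltrans X dot x\<close> and \<open>\<delta>\<^sub>x\<close> is \<open>ltrans X col x\<close>.\<close>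

definition ltrans :: "'a set \<Rightarrow> ('a \<Rightarrow> 'a \<Rightarrow> 'a) \<Rightarrow> 'a \<Rightarrow> 'a \<Rightarrow> 'a"
  where "ltrans X op x = restrict (op x) X"

definition perm_group ::
  "'a set \<Rightarrow> ('a \<Rightarrow> 'a \<Rightarrow> 'a) \<Rightarrow> ('a \<Rightarrow> 'a \<Rightarrow> 'a) \<Rightarrow> ('a \<Rightarrow> 'a) monoid"
  where "perm_group X dot col =
    BijGroup X \<lparr>carrier := generate (BijGroup X) (ltrans X dot ` X \<union> ltrans X col ` X)\<rparr>"

definition Dis ::
  "'a set \<Rightarrow> ('a \<Rightarrow> 'a \<Rightarrow> 'a) \<Rightarrow> ('a \<Rightarrow> 'a \<Rightarrow> 'a) \<Rightarrow> 'a set \<Rightarrow> ('a \<Rightarrow> 'a) set"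
  where "Dis X dot col \<Delta> =
    generate (BijGroup X)
      ({inv\<^bsub>BijGroup X\<^esub> (ltrans X dot x) \<otimes>\<^bsub>BijGroup X\<^esub> ltrans X dot y | x y. x \<in> \<Delta> \<and> y \<in> \<Delta>} \<union>
       {inv\<^bsub>BijGroup X\<^esub> (ltrans X col x) \<otimes>\<^bsub>BijGroup X\<^esub> ltrans X col y | x y. x \<in> \<Delta> \<and> y \<in> \<Delta>})"

text \<open>Blocks for an action \<open>\<phi>\<close> of \<open>G\<close> on \<open>X\<close>; meant for transitive actions.\<close>

definition is_block ::
  "('g, 'm) monoid_scheme \<Rightarrow> 'a set \<Rightarrow> ('g \<Rightarrow> 'a \<Rightarrow> 'a) \<Rightarrow> 'a set \<Rightarrow> bool"
  where "is_block G X \<phi> \<Delta> \<longleftrightarrow>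
    \<Delta> \<subset> X \<and> (\<exists>x\<in>\<Delta>. \<exists>y\<in>\<Delta>. x \<noteq> y) \<and>
    (\<forall>g\<in>carrier G. \<phi> g ` \<Delta> = \<Delta> \<or> \<phi> g ` \<Delta> \<inter> \<Delta> = {})"

definition blocks_system ::
  "('g, 'm) monoid_scheme \<Rightarrow> 'a set \<Rightarrow> ('g \<Rightarrow> 'a \<Rightarrow> 'a) \<Rightarrow> 'a set set \<Rightarrow> bool"
  where "blocks_system G X \<phi> \<B> \<longleftrightarrow>
    (\<exists>\<Delta>. is_block G X \<phi> \<Delta> \<and> \<B> = {\<phi> g ` \<Delta> | g. g \<in> carrier G})"

definition block_at :: "'a set set \<Rightarrow> 'a \<Rightarrow> 'a set"
  where "block_at \<B> x = (THE \<Delta>. \<Delta> \<in> \<B> \<and> x \<in> \<Delta>)"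

definition Fix :: "('g, 'm) monoid_scheme \<Rightarrow> ('g \<Rightarrow> 'a \<Rightarrow> 'a) \<Rightarrow> 'a set set \<Rightarrow> 'g set"
  where "Fix G \<phi> \<B> = (\<Inter>\<Delta>\<in>\<B>. stabilizer G (\<lambda>g S. \<phi> g ` S) \<Delta>)"

text \<open>The permutation group acts on \<open>X\<close> by evaluation, that is, by \<open>id\<close>.\<close>

abbreviation acts_transitively ::
  "'a set \<Rightarrow> ('a \<Rightarrow> 'a \<Rightarrow> 'a) \<Rightarrow> ('a \<Rightarrow> 'a \<Rightarrow> 'a) \<Rightarrow> bool"
  where "acts_transitively X dot col \<equiv> transitive_action (perm_group X dot col) X id"

text \<open>The q-cycle set with two elements and both operations equal to the second projection is
  simple, because it has no proper quotient with more than one element, but its permutation group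
  is trivial and hence not transitive.  The characterization of simplicity by transitivity and
  blocks therefore has to exclude this one q-cycle set.\<close>

definition two_element_projection ::
  "'a set \<Rightarrow> ('a \<Rightarrow> 'a \<Rightarrow> 'a) \<Rightarrow> ('a \<Rightarrow> 'a \<Rightarrow> 'a) \<Rightarrow> bool"
  where "two_element_projection X dot col \<longleftrightarrow>
    card X = 2 \<and> (\<forall>x\<in>X. \<forall>y\<in>X. dot x y = y \<and> col x y = y)"

lemma two_element_projection_simple_not_transitive:
  assumes two: "two_element_projection X dot col"
  shows "simple_q_cycle_set X dot col" and "\<not> acts_transitively X dot col"
proof -
  have card: "card X = 2" and fin: "finite X"
    and triv: "\<And>x y. x \<in> X \<Longrightarrow> y \<in> X \<Longrightarrow> dot x y = y \<and> col x y = y"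
    using two by (auto simp: two_element_projection_def intro: card_ge_0_finite)
  have bij: "bij_betw (\<lambda>y. dot x y) X X" "bij_betw (\<lambda>y. col x y) X X" if "x \<in> X" for x
    using that triv by (auto simp: bij_betw_def inj_on_def)
  have reg: "regular_q_cycle_set X dot col"
  proof
    show "X \<noteq> {}" using card by auto
  qed (auto simp: bij triv)
  show "simple_q_cycle_set X dot col"
    unfolding simple_q_cycle_set_def
  proof (intro conjI allI impI)
    fix Y :: "'a set" and dot' col' f
    assume A: "q_cycle_set Y dot' col' \<and> q_cycle_epi X dot col Y dot' col' f"
    then have fX: "f ` X = Y" and "Y \<noteq> {}"
      by (auto simp: q_cycle_epi_def q_cycle_set_def)
    moreover have "card Y \<le> 2" "finite Y"
      using fX fin card card_image_le[of X f] by auto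
    ultimately have "card Y = 1 \<or> card Y = 2"
      by (metis One_nat_def Suc_1 card_0_eq le_SucE le_zero_eq)
    then show "bij_betw f X Y \<or> card Y = 1"
      using fX fin card by (metis bij_betw_def eq_card_imp_inj_on)
  qed (use reg fin card in auto)
  show "\<not> acts_transitively X dot col"
  proof
    assume tr: "acts_transitively X dot col"
    have one: "ltrans X dot x = \<one>\<^bsub>BijGroup X\<^esub>" "ltrans X col x = \<one>\<^bsub>BijGroup X\<^esub>" if "x \<in> X" for x
      using that triv by (auto simp: ltrans_def BijGroup_def restrict_def)
    have "g = \<one>\<^bsub>BijGroup X\<^esub>"
      if "g \<in> generate (BijGroup X) (ltrans X dot ` X \<union> ltrans X col ` X)" for g
      using that
    proof induction
      case (inv h)
      then show ?case using one monoid.inv_one[OF group.is_monoid[OF group_BijGroup, of X]] by auto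
    next
      case (eng h1 h2)
      then show ?case using group.is_monoid[OF group_BijGroup, of X]
        by (simp add: monoid.l_one monoid.one_closed)
    qed (use one in auto)
    moreover have "\<one>\<^bsub>BijGroup X\<^esub> x = x" if "x \<in> X" for x
      using that by (simp add: BijGroup_def)
    ultimately have gen: "g x = x" if "g \<in> carrier (perm_group X dot col)" "x \<in> X" for g x
      using that by (simp add: perm_group_def)
    obtain x y where "x \<in> X" "y \<in> X" "x \<noteq> y"
      using card by (auto simp: card_2_iff)
    moreover obtain g where "g \<in> carrier (perm_group X dot col)" "id g x = y"
      using transitive_action.unique_orbit[OF tr \<open>x \<in> X\<close> \<open>y \<in> X\<close>] by blast
    ultimately show False by (metis gen id_apply)
  qed
qed

end

theory Submission
  imports Defs
begin

text \<open>Quotients of a finite regular q-cycle set \<open>X\<close> are the same thing as congruences, and a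
  congruence is handled here as the kernel of an arbitrary map \<open>f\<close> on \<open>X\<close>: the kernel is a
  congruence exactly if \<open>f\<close> turns \<open>X\<close> into a q-cycle set \<open>f ` X\<close> (\<open>q_cycle_set_quotient\<close>).
  Finiteness makes each \<open>\<sigma>\<^sub>x\<close> and \<open>\<delta>\<^sub>x\<close> not only map fibres of \<open>f\<close> into fibres, but permute the
  fibres, so the whole permutation group does (\<open>perm_group_permutes_fibres\<close>).  What a congruence
  demands beyond this invariance is that \<open>\<sigma>\<^sub>x\<close> and \<open>\<sigma>\<^sub>y\<close> induce the same permutation of the fibres
  whenever \<open>x\<close> and \<open>y\<close> lie in one fibre, and likewise for \<open>\<delta>\<close>.  That demand says precisely that
  \<open>Dis\<close> of each fibre fixes all fibres.

  For a transitive permutation group, the invariant partitions with classes that are neither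
  singletons nor all of \<open>X\<close> are the blocks systems.  Hence the non-trivial congruences
  are the blocks systems \<open>\<B>\<close> with \<open>Dis\<close> of every block inside \<open>Fix \<B>\<close>, and simplicity means that
  there are none.  Transitivity itself follows from simplicity because the orbit map is always a
  quotient map, onto a q-cycle set with both operations equal to the second projection; if it is
  injective then \<open>X\<close> has these operations too, every map on \<open>X\<close> is a quotient map, and only
  \<open>card X = 2\<close> is compatible with simplicity.\<close>

section \<open>Permutations that respect the fibres of a map\<close>

lemma carrier_BijGroup: "carrier (BijGroup X) = Bij X"
  by (simp add: BijGroup_def)

lemma BijGroup_mult_apply:
  assumes "g \<in> Bij X" "h \<in> Bij X" "x \<in> X"
  shows "(g \<otimes>\<^bsub>BijGroup X\<^esub> h) x = g (h x)"
  using assms by (simp add: BijGroup_def compose_def)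

lemma BijGroup_inv_in_Bij:
  assumes "h \<in> Bij X"
  shows "inv\<^bsub>BijGroup X\<^esub> h \<in> Bij X"
  using group.inv_closed[OF group_BijGroup, of h X] assms by (simp add: carrier_BijGroup)

lemma BijGroup_apply_inv:
  assumes "h \<in> Bij X" "x \<in> X"
  shows "h ((inv\<^bsub>BijGroup X\<^esub> h) x) = x"
proof -
  have "h \<otimes>\<^bsub>BijGroup X\<^esub> inv\<^bsub>BijGroup X\<^esub> h = \<one>\<^bsub>BijGroup X\<^esub>"
    using group.r_inv[OF group_BijGroup, of h X] assms by (simp add: carrier_BijGroup)
  moreover have "\<one>\<^bsub>BijGroup X\<^esub> x = x"
    using assms(2) by (simp add: BijGroup_def)
  ultimately have "(h \<otimes>\<^bsub>BijGroup X\<^esub> inv\<^bsub>BijGroup X\<^esub> h) x = x" by simp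
  then show ?thesis
    using BijGroup_mult_apply[OF assms(1) BijGroup_inv_in_Bij[OF assms(1)] assms(2)] by simp
qed

lemma Bij_apply_in: "\<lbrakk>g \<in> Bij X; x \<in> X\<rbrakk> \<Longrightarrow> g x \<in> X"
  by (rule funcset_mem[OF Bij_imp_funcset])

lemma BijGroup_subgroupI:
  assumes "\<And>g. g \<in> H \<Longrightarrow> g \<in> Bij X"
    and "(\<lambda>x\<in>X. x) \<in> H"
    and "\<And>g h. \<lbrakk>g \<in> H; h \<in> H\<rbrakk> \<Longrightarrow> g \<otimes>\<^bsub>BijGroup X\<^esub> h \<in> H"
    and "\<And>g. g \<in> H \<Longrightarrow> inv\<^bsub>BijGroup X\<^esub> g \<in> H"
  shows "subgroup H (BijGroup X)"
proof (rule subgroup.intro)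
  show "H \<subseteq> carrier (BijGroup X)" using assms(1) by (auto simp: carrier_BijGroup)
  show "\<one>\<^bsub>BijGroup X\<^esub> \<in> H" using assms(2) by (simp add: BijGroup_def)
qed (fact assms)+

lemma BijGroup_mult_in_Bij:
  assumes "g \<in> Bij X" "h \<in> Bij X"
  shows "g \<otimes>\<^bsub>BijGroup X\<^esub> h \<in> Bij X"
  using assms by (simp add: BijGroup_def compose_Bij)

text \<open>The equivalence, instead of an implication, makes membership pass to inverses on infinite
  sets too, so that these permutations form a group.\<close>

definition permutes_fibres :: "'a set \<Rightarrow> ('a \<Rightarrow> 'b) \<Rightarrow> ('a \<Rightarrow> 'a) set" where
  "permutes_fibres X f =
    {g \<in> Bij X. \<forall>x\<in>X. \<forall>y\<in>X. f (g x) = f (g y) \<longleftrightarrow> f x = f y}"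

definition fixes_fibres :: "'a set \<Rightarrow> ('a \<Rightarrow> 'b) \<Rightarrow> ('a \<Rightarrow> 'a) set" where
  "fixes_fibres X f = {g \<in> Bij X. \<forall>x\<in>X. f (g x) = f x}"

lemma permutes_fibresD:
  "\<lbrakk>g \<in> permutes_fibres X f; x \<in> X; y \<in> X\<rbrakk> \<Longrightarrow> f (g x) = f (g y) \<longleftrightarrow> f x = f y"
  by (simp add: permutes_fibres_def)

lemma fixes_fibresD: "\<lbrakk>g \<in> fixes_fibres X f; x \<in> X\<rbrakk> \<Longrightarrow> f (g x) = f x"
  by (simp add: fixes_fibres_def)

lemma subgroup_permutes_fibres: "subgroup (permutes_fibres X f) (BijGroup X)"
proof (rule BijGroup_subgroupI)
  fix g assume g: "g \<in> permutes_fibres X f"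
  then show gB: "g \<in> Bij X" by (simp add: permutes_fibres_def)
  let ?i = "inv\<^bsub>BijGroup X\<^esub> g"
  have "f (?i x) = f (?i y) \<longleftrightarrow> f x = f y" if "x \<in> X" "y \<in> X" for x y
  proof -
    have "?i x \<in> X" "?i y \<in> X" using that BijGroup_inv_in_Bij[OF gB] by (auto intro: Bij_apply_in)
    then have "f (g (?i x)) = f (g (?i y)) \<longleftrightarrow> f (?i x) = f (?i y)"
      by (rule permutes_fibresD[OF g])
    then show ?thesis using BijGroup_apply_inv[OF gB] that by simp
  qed
  then show "inv\<^bsub>BijGroup X\<^esub> g \<in> permutes_fibres X f"
    using BijGroup_inv_in_Bij[OF gB] by (simp add: permutes_fibres_def)
next
  fix g h assume gh: "g \<in> permutes_fibres X f" "h \<in> permutes_fibres X f"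
  then have B: "g \<in> Bij X" "h \<in> Bij X" by (auto simp: permutes_fibres_def)
  have "f ((g \<otimes>\<^bsub>BijGroup X\<^esub> h) x) = f ((g \<otimes>\<^bsub>BijGroup X\<^esub> h) y) \<longleftrightarrow> f x = f y" if xy: "x \<in> X" "y \<in> X" for x y
  proof -
    have "f (g (h x)) = f (g (h y)) \<longleftrightarrow> f (h x) = f (h y)"
      by (rule permutes_fibresD[OF gh(1) Bij_apply_in[OF B(2) xy(1)] Bij_apply_in[OF B(2) xy(2)]])
    also have "\<dots> \<longleftrightarrow> f x = f y" by (rule permutes_fibresD[OF gh(2) xy])
    finally show ?thesis using BijGroup_mult_apply[OF B] xy by simp
  qed
  then show "g \<otimes>\<^bsub>BijGroup X\<^esub> h \<in> permutes_fibres X f"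
    using BijGroup_mult_in_Bij[OF B] by (simp add: permutes_fibres_def)
qed (simp add: permutes_fibres_def id_Bij)

lemma subgroup_fixes_fibres: "subgroup (fixes_fibres X f) (BijGroup X)"
proof (rule BijGroup_subgroupI)
  fix g assume g: "g \<in> fixes_fibres X f"
  then show gB: "g \<in> Bij X" by (simp add: fixes_fibres_def)
  let ?i = "inv\<^bsub>BijGroup X\<^esub> g"
  have "f (?i x) = f x" if "x \<in> X" for x
  proof -
    have "?i x \<in> X" using that BijGroup_inv_in_Bij[OF gB] by (rule Bij_apply_in[rotated])
    then have "f (g (?i x)) = f (?i x)" by (rule fixes_fibresD[OF g])
    then show ?thesis using BijGroup_apply_inv[OF gB that] by simp
  qed
  then show "inv\<^bsub>BijGroup X\<^esub> g \<in> fixes_fibres X f"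
    using BijGroup_inv_in_Bij[OF gB] by (simp add: fixes_fibres_def)
next
  fix g h assume gh: "g \<in> fixes_fibres X f" "h \<in> fixes_fibres X f"
  then have B: "g \<in> Bij X" "h \<in> Bij X" by (auto simp: fixes_fibres_def)
  have "f ((g \<otimes>\<^bsub>BijGroup X\<^esub> h) x) = f x" if xy: "x \<in> X" for x
  proof -
    have "f (g (h x)) = f (h x)" by (rule fixes_fibresD[OF gh(1) Bij_apply_in[OF B(2) xy]])
    also have "\<dots> = f x" by (rule fixes_fibresD[OF gh(2) xy])
    finally show ?thesis using BijGroup_mult_apply[OF B] xy by simp
  qed
  then show "g \<otimes>\<^bsub>BijGroup X\<^esub> h \<in> fixes_fibres X f"
    using BijGroup_mult_in_Bij[OF B] by (simp add: fixes_fibres_def)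
qed (simp add: fixes_fibres_def id_Bij)

text \<open>The map that \<open>h\<close> induces on the finite set of fibres is surjective, hence injective.\<close>

lemma finite_bij_preserving_fibres_reflects:
  assumes fin: "finite X" and h: "bij_betw h X X"
    and pres: "\<And>x y. \<lbrakk>x \<in> X; y \<in> X; f x = f y\<rbrakk> \<Longrightarrow> f (h x) = f (h y)"
    and x: "x \<in> X" and y: "y \<in> X" and eq: "f (h x) = f (h y)"
  shows "f x = f y"
proof -
  define k where "k = (\<lambda>a. f (h (inv_into X f a)))"
  have k: "k (f z) = f (h z)" if "z \<in> X" for z
    unfolding k_def using that by (intro pres) (auto simp: inv_into_into f_inv_into_f)
  have "k ` f ` X = f ` h ` X" using k by (auto simp: image_image)
  then have "k ` f ` X = f ` X" using h by (simp add: bij_betw_def)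
  then have "inj_on k (f ` X)" using fin by (simp add: eq_card_imp_inj_on)
  then show ?thesis using x y eq k by (metis image_eqI inj_onD)
qed

section \<open>Quotients and the permutation group\<close>

definition congruence_map ::
  "'a set \<Rightarrow> ('a \<Rightarrow> 'a \<Rightarrow> 'a) \<Rightarrow> ('a \<Rightarrow> 'a \<Rightarrow> 'a) \<Rightarrow> ('a \<Rightarrow> 'b) \<Rightarrow> bool" where
  "congruence_map X dot col f \<longleftrightarrow>
    (\<forall>x\<in>X. \<forall>x'\<in>X. \<forall>y\<in>X. \<forall>y'\<in>X. f x = f x' \<longrightarrow> f y = f y' \<longrightarrow>
      f (dot x y) = f (dot x' y') \<and> f (col x y) = f (col x' y'))"

lemma congruence_mapD:
  assumes "congruence_map X dot col f" "x \<in> X" "x' \<in> X" "y \<in> X" "y' \<in> X" "f x = f x'" "f y = f y'"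
  shows "f (dot x y) = f (dot x' y')" and "f (col x y) = f (col x' y')"
  using assms unfolding congruence_map_def by blast+

lemma q_cycle_epi_congruence_map:
  assumes "q_cycle_epi X dot col Y dot' col' f"
  shows "congruence_map X dot col f"
  using assms unfolding q_cycle_epi_def congruence_map_def by simp

context regular_q_cycle_set
begin

abbreviation "PG \<equiv> perm_group X (\<cdot>) (\<Ztypecolon>)"

lemma dot_closed: "\<lbrakk>x \<in> X; y \<in> X\<rbrakk> \<Longrightarrow> x \<cdot> y \<in> X"
  using dot_bij by (auto simp: bij_betw_def)

text \<open>The equational axioms pass to the image of \<open>f\<close>.  The left translations of the image are
  surjective because those of \<open>X\<close> are, and finiteness makes them bijective.\<close>

lemma q_cycle_set_quotient:
  assumes fin: "finite X" and f: "congruence_map X (\<cdot>) (\<Ztypecolon>) f"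
  obtains dot' col' where "q_cycle_set (f ` X) dot' col'"
    and "q_cycle_epi X (\<cdot>) (\<Ztypecolon>) (f ` X) dot' col' f"
proof -
  define s where "s = inv_into X f"
  define d where "d = (\<lambda>a b. f (s a \<cdot> s b))"
  define c where "c = (\<lambda>a b. f (s a \<Ztypecolon> s b))"
  have s: "s (f x) \<in> X" "f (s (f x)) = f x" if "x \<in> X" for x
    using that by (auto simp: s_def inv_into_into f_inv_into_f)
  have d: "d (f x) (f y) = f (x \<cdot> y)" if "x \<in> X" "y \<in> X" for x y
    unfolding d_def using that s by (intro congruence_mapD(1)[OF f]) auto
  have c: "c (f x) (f y) = f (x \<Ztypecolon> y)" if "x \<in> X" "y \<in> X" for x y
    unfolding c_def using that s by (intro congruence_mapD(2)[OF f]) auto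
  have "bij_betw (\<lambda>b. d (f x) b) (f ` X) (f ` X)" if x: "x \<in> X" for x
  proof -
    have "(\<lambda>b. d (f x) b) ` f ` X = f ` (\<lambda>y. x \<cdot> y) ` X"
      using d[OF x] by (auto simp: image_image)
    then have "(\<lambda>b. d (f x) b) ` f ` X = f ` X"
      using dot_bij[OF x] by (simp add: bij_betw_def)
    then show ?thesis using fin by (simp add: bij_betw_def eq_card_imp_inj_on)
  qed
  then have "q_cycle_set (f ` X) d c"
    by unfold_locales
      (auto simp: nonempty d c dot_closed col_closed dot_dot col_col dot_col)
  moreover have "q_cycle_epi X (\<cdot>) (\<Ztypecolon>) (f ` X) d c f"
    using d c by (simp add: q_cycle_epi_def)
  ultimately show thesis by (rule that)
qed

corollary simple_congruence_map_trivial: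
  assumes "simple_q_cycle_set X (\<cdot>) (\<Ztypecolon>)" and "congruence_map X (\<cdot>) (\<Ztypecolon>) f"
  shows "inj_on f X \<or> (\<forall>x\<in>X. \<forall>y\<in>X. f x = f y)"
proof -
  have "finite X" using assms(1) by (simp add: simple_q_cycle_set_def)
  then obtain dot' col' where "q_cycle_set (f ` X) dot' col'"
    and "q_cycle_epi X (\<cdot>) (\<Ztypecolon>) (f ` X) dot' col' f"
    using q_cycle_set_quotient[OF _ assms(2)] by metis
  then have "bij_betw f X (f ` X) \<or> card (f ` X) = 1"
    by (rule simple_q_cycle_set_any_type[OF assms(1)])
  then show ?thesis
    unfolding bij_betw_def by (metis card_1_singletonE image_eqI singletonD)
qed

lemma ltrans_in_Bij:
  assumes "x \<in> X"
  shows "ltrans X (\<cdot>) x \<in> Bij X" and "ltrans X (\<Ztypecolon>) x \<in> Bij X"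
  using dot_bij[OF assms] col_bij[OF assms]
  by (auto simp: ltrans_def Bij_def cong: bij_betw_cong)

lemma generators_in_BijGroup:
  "ltrans X (\<cdot>) ` X \<union> ltrans X (\<Ztypecolon>) ` X \<subseteq> carrier (BijGroup X)"
  using ltrans_in_Bij by (auto simp: carrier_BijGroup)

lemma subgroup_perm_group: "subgroup (carrier PG) (BijGroup X)"
  using group.generate_is_subgroup[OF group_BijGroup generators_in_BijGroup]
  by (simp add: perm_group_def)

lemma perm_group_eq: "PG = BijGroup X\<lparr>carrier := carrier PG\<rparr>"
  by (simp add: perm_group_def)

lemma perm_group_in_Bij: "g \<in> carrier PG \<Longrightarrow> g \<in> Bij X"
  using subgroup.subset[OF subgroup_perm_group] by (auto simp: carrier_BijGroup)

lemma ltrans_in_perm_group: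
  assumes "x \<in> X"
  shows "ltrans X (\<cdot>) x \<in> carrier PG" and "ltrans X (\<Ztypecolon>) x \<in> carrier PG"
  using assms by (auto simp: perm_group_def intro: generate.incl)

lemma group_action_perm_group: "group_action PG X id"
proof -
  have "group PG"
    using group.subgroup_imp_group[OF group_BijGroup subgroup_perm_group] perm_group_eq by simp
  moreover have "id \<in> hom PG (BijGroup X)"
    using subgroup.subset[OF subgroup_perm_group] by (auto simp: hom_def perm_group_def)
  ultimately show ?thesis
    by (simp add: group_action_def group_hom_def group_hom_axioms_def group_BijGroup)
qed

lemma perm_group_permutes_fibres:
  assumes fin: "finite X" and f: "congruence_map X (\<cdot>) (\<Ztypecolon>) f"
  shows "carrier PG \<subseteq> permutes_fibres X f"
proof -
  have "f (x \<cdot> y) = f (x \<cdot> z) \<longleftrightarrow> f y = f z" "f (x \<Ztypecolon> y) = f (x \<Ztypecolon> z) \<longleftrightarrow> f y = f z"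
    if "x \<in> X" "y \<in> X" "z \<in> X" for x y z
    using finite_bij_preserving_fibres_reflects[OF fin dot_bij[OF that(1)], of f y z]
      finite_bij_preserving_fibres_reflects[OF fin col_bij[OF that(1)], of f y z]
      congruence_mapD[OF f that(1) that(1)] that by blast+
  then have "ltrans X (\<cdot>) ` X \<union> ltrans X (\<Ztypecolon>) ` X \<subseteq> permutes_fibres X f"
    using ltrans_in_Bij by (auto simp: permutes_fibres_def ltrans_def)
  from group.generate_subgroup_incl[OF group_BijGroup this subgroup_permutes_fibres]
  show ?thesis by (simp add: perm_group_def)
qed

lemma Dis_subset_perm_group:
  assumes "\<Delta> \<subseteq> X"
  shows "Dis X (\<cdot>) (\<Ztypecolon>) \<Delta> \<subseteq> carrier PG"
  unfolding Dis_def
  by (rule group.generate_subgroup_incl[OF group_BijGroup _ subgroup_perm_group])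
    (use assms ltrans_in_perm_group in
      \<open>auto intro!: subgroup.m_closed[OF subgroup_perm_group]
        subgroup.m_inv_closed[OF subgroup_perm_group]\<close>)

text \<open>If two permutations \<open>g\<close>, \<open>h\<close> of the fibres agree on fibres, then \<open>g\<inverse>h\<close> fixes every fibre:
  \<open>w = (g\<inverse>h) z\<close> satisfies \<open>g w = h z\<close>, which lies in the fibre of \<open>g z\<close>.\<close>

lemma inv_mult_fixes_fibres:
  assumes g: "g \<in> permutes_fibres X f" and h: "h \<in> Bij X"
    and eq: "\<And>z. z \<in> X \<Longrightarrow> f (h z) = f (g z)"
  shows "inv\<^bsub>BijGroup X\<^esub> g \<otimes>\<^bsub>BijGroup X\<^esub> h \<in> fixes_fibres X f"
proof -
  have gB: "g \<in> Bij X" using g by (simp add: permutes_fibres_def)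
  let ?k = "inv\<^bsub>BijGroup X\<^esub> g \<otimes>\<^bsub>BijGroup X\<^esub> h"
  have kB: "?k \<in> Bij X" using BijGroup_mult_in_Bij BijGroup_inv_in_Bij gB h by blast
  have "f (?k z) = f z" if z: "z \<in> X" for z
  proof -
    have "g (?k z) = h z"
      using z by (simp add: BijGroup_mult_apply BijGroup_inv_in_Bij gB h BijGroup_apply_inv Bij_apply_in)
    then have "f (g (?k z)) = f (g z)" using eq[OF z] by simp
    then show ?thesis
      using permutes_fibresD[OF g Bij_apply_in[OF kB z] z] by simp
  qed
  with kB show ?thesis by (simp add: fixes_fibres_def)
qed

text \<open>Elements \<open>x\<close>, \<open>y\<close> of one fibre become equal in the quotient, so \<open>\<sigma>\<^sub>x\<close> and \<open>\<sigma>\<^sub>y\<close> induce the same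
  permutation of the fibres, and the generators of \<open>Dis\<close> act trivially on the quotient.\<close>

lemma Dis_fixes_fibres:
  assumes fin: "finite X" and f: "congruence_map X (\<cdot>) (\<Ztypecolon>) f" and sub: "\<Delta> \<subseteq> X"
    and const: "\<And>x y. \<lbrakk>x \<in> \<Delta>; y \<in> \<Delta>\<rbrakk> \<Longrightarrow> f x = f y"
  shows "Dis X (\<cdot>) (\<Ztypecolon>) \<Delta> \<subseteq> fixes_fibres X f"
proof -
  have pf: "ltrans X (\<cdot>) x \<in> permutes_fibres X f" "ltrans X (\<Ztypecolon>) x \<in> permutes_fibres X f"
    if "x \<in> X" for x
    using perm_group_permutes_fibres[OF fin f] ltrans_in_perm_group[OF that] by auto
  have "inv\<^bsub>BijGroup X\<^esub> (ltrans X (\<cdot>) x) \<otimes>\<^bsub>BijGroup X\<^esub> ltrans X (\<cdot>) y \<in> fixes_fibres X f"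
    "inv\<^bsub>BijGroup X\<^esub> (ltrans X (\<Ztypecolon>) x) \<otimes>\<^bsub>BijGroup X\<^esub> ltrans X (\<Ztypecolon>) y \<in> fixes_fibres X f"
    if xy: "x \<in> \<Delta>" "y \<in> \<Delta>" for x y
  proof -
    have mem: "x \<in> X" "y \<in> X" using xy sub by auto
    have "f (ltrans X (\<cdot>) y z) = f (ltrans X (\<cdot>) x z)"
      "f (ltrans X (\<Ztypecolon>) y z) = f (ltrans X (\<Ztypecolon>) x z)" if z: "z \<in> X" for z
      using congruence_mapD[OF f mem(2,1) z z const[OF xy(2,1)]] z by (simp_all add: ltrans_def)
    then show
      "inv\<^bsub>BijGroup X\<^esub> (ltrans X (\<cdot>) x) \<otimes>\<^bsub>BijGroup X\<^esub> ltrans X (\<cdot>) y \<in> fixes_fibres X f"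
      "inv\<^bsub>BijGroup X\<^esub> (ltrans X (\<Ztypecolon>) x) \<otimes>\<^bsub>BijGroup X\<^esub> ltrans X (\<Ztypecolon>) y \<in> fixes_fibres X f"
      using inv_mult_fixes_fibres[OF pf(1)[OF mem(1)] ltrans_in_Bij(1)[OF mem(2)]]
        inv_mult_fixes_fibres[OF pf(2)[OF mem(1)] ltrans_in_Bij(2)[OF mem(2)]] by blast+
  qed
  then show ?thesis
    unfolding Dis_def
    by (intro group.generate_subgroup_incl[OF group_BijGroup _ subgroup_fixes_fibres]) blast
qed

end

section \<open>Blocks systems\<close>

lemma (in group_action) image_mult:
  assumes "g \<in> carrier G" "h \<in> carrier G" "A \<subseteq> E"
  shows "\<phi> (g \<otimes> h) ` A = \<phi> g ` \<phi> h ` A"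
  unfolding image_image
  by (rule image_cong) (use assms in \<open>auto intro!: composition_rule\<close>)

text \<open>If \<open>g \<Delta>\<close> and \<open>h \<Delta>\<close> share a point, then \<open>g\<inverse>h\<close> moves a point of \<open>\<Delta>\<close> into \<open>\<Delta>\<close>, hence stabilizes
  the block \<open>\<Delta>\<close>, and \<open>g \<Delta> = h \<Delta>\<close>.  Thus the definite description in \<open>block_at\<close> is proper, and
  \<open>block_at \<B>\<close> can serve as a map whose fibres are the blocks.\<close>

lemma (in transitive_action) block_at_eq:
  assumes \<B>: "blocks_system G E \<phi> \<B>" and S: "S \<in> \<B>" "x \<in> S"
  shows "block_at \<B> x = S"
proof -
  interpret group G using group_hom group_hom.axioms(1) by auto
  obtain \<Delta> where \<Delta>: "is_block G E \<phi> \<Delta>" and \<B>_eq: "\<B> = {\<phi> g ` \<Delta> | g. g \<in> carrier G}"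
    using \<B> by (auto simp: blocks_system_def)
  have sub: "\<Delta> \<subseteq> E" using \<Delta> by (auto simp: is_block_def)
  have unique: "T = S" if T: "T \<in> \<B>" "x \<in> T" for T
  proof -
    obtain g h where g: "g \<in> carrier G" "S = \<phi> g ` \<Delta>" and h: "h \<in> carrier G" "T = \<phi> h ` \<Delta>"
      using S(1) T(1) \<B>_eq by auto
    obtain a b where a: "a \<in> \<Delta>" "x = \<phi> g a" and b: "b \<in> \<Delta>" "x = \<phi> h b"
      using S T g h by auto
    let ?k = "inv g \<otimes> h"
    have k: "?k \<in> carrier G" using g h by simp
    have "\<phi> ?k b = \<phi> (inv g) x" using b g h sub by (auto simp: composition_rule)
    also have "\<dots> = a" using orbit_sym_aux[OF g(1)] a sub by auto
    finally have "\<phi> ?k ` \<Delta> \<inter> \<Delta> \<noteq> {}" using a b by force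
    then have kD: "\<phi> ?k ` \<Delta> = \<Delta>" using \<Delta> k unfolding is_block_def by blast
    have "h = g \<otimes> ?k" using g h by (simp add: m_assoc[symmetric])
    then have "T = \<phi> g ` \<phi> ?k ` \<Delta>" using h image_mult[OF g(1) k sub] by simp
    then show ?thesis using kD g by simp
  qed
  show ?thesis
    unfolding block_at_def
  proof (rule the_equality)
    show "S \<in> \<B> \<and> x \<in> S" using S by simp
  qed (elim conjE, rule unique)
qed

lemma (in transitive_action) block_at_mem:
  assumes \<B>: "blocks_system G E \<phi> \<B>" and x: "x \<in> E"
  shows "block_at \<B> x \<in> \<B>" and "x \<in> block_at \<B> x"
proof -
  obtain \<Delta> where \<Delta>: "is_block G E \<phi> \<Delta>" and \<B>_eq: "\<B> = {\<phi> g ` \<Delta> | g. g \<in> carrier G}"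
    using \<B> by (auto simp: blocks_system_def)
  obtain d where d: "d \<in> \<Delta>" "d \<in> E" using \<Delta> by (auto simp: is_block_def)
  obtain g where "g \<in> carrier G" "\<phi> g d = x" using unique_orbit[OF d(2) x] by auto
  then have "\<phi> g ` \<Delta> \<in> \<B>" "x \<in> \<phi> g ` \<Delta>" using \<B>_eq d by auto
  with block_at_eq[OF \<B>] show "block_at \<B> x \<in> \<B>" "x \<in> block_at \<B> x" by auto
qed

lemma (in transitive_action) block_at_subset:
  assumes \<B>: "blocks_system G E \<phi> \<B>" and x: "x \<in> E"
  shows "block_at \<B> x \<subseteq> E"
proof -
  obtain \<Delta> where \<Delta>: "is_block G E \<phi> \<Delta>" and \<B>_eq: "\<B> = {\<phi> g ` \<Delta> | g. g \<in> carrier G}"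
    using \<B> by (auto simp: blocks_system_def)
  obtain g where g: "g \<in> carrier G" "block_at \<B> x = \<phi> g ` \<Delta>"
    using block_at_mem(1)[OF \<B> x] \<B>_eq by auto
  have "\<Delta> \<subseteq> E" using \<Delta> by (auto simp: is_block_def)
  then have "\<phi> g ` \<Delta> \<subseteq> \<phi> g ` E" by (rule image_mono)
  then show ?thesis using g surj_prop[OF g(1)] by simp
qed

lemma (in transitive_action) block_at_equivariant:
  assumes \<B>: "blocks_system G E \<phi> \<B>" and g: "g \<in> carrier G" and x: "x \<in> E"
  shows "block_at \<B> (\<phi> g x) = \<phi> g ` block_at \<B> x"
proof (rule block_at_eq[OF \<B>])
  interpret group G using group_hom group_hom.axioms(1) by auto
  obtain \<Delta> where \<Delta>: "is_block G E \<phi> \<Delta>" and \<B>_eq: "\<B> = {\<phi> g ` \<Delta> | g. g \<in> carrier G}"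
    using \<B> by (auto simp: blocks_system_def)
  obtain h where h: "h \<in> carrier G" "block_at \<B> x = \<phi> h ` \<Delta>"
    using block_at_mem(1)[OF \<B> x] \<B>_eq by auto
  have "\<Delta> \<subseteq> E" using \<Delta> by (auto simp: is_block_def)
  then have "\<phi> g ` block_at \<B> x = \<phi> (g \<otimes> h) ` \<Delta>"
    using image_mult[OF g h(1)] h(2) by simp
  moreover have "g \<otimes> h \<in> carrier G" using g h(1) by simp
  ultimately show "\<phi> g ` block_at \<B> x \<in> \<B>" using \<B>_eq by blast
  show "\<phi> g x \<in> \<phi> g ` block_at \<B> x" using block_at_mem(2)[OF \<B> x] by simp
qed

lemma (in transitive_action) block_at_nontrivial:
  assumes \<B>: "blocks_system G E \<phi> \<B>"
  shows "\<not> inj_on (block_at \<B>) E" and "\<not> (\<forall>x\<in>E. \<forall>y\<in>E. block_at \<B> x = block_at \<B> y)"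
proof -
  interpret group G using group_hom group_hom.axioms(1) by auto
  obtain \<Delta> where \<Delta>: "is_block G E \<phi> \<Delta>" and \<B>_eq: "\<B> = {\<phi> g ` \<Delta> | g. g \<in> carrier G}"
    using \<B> by (auto simp: blocks_system_def)
  have sub: "\<Delta> \<subset> E" using \<Delta> by (auto simp: is_block_def)
  then have "\<phi> \<one> ` \<Delta> = \<Delta>" by (subst id_eq_one[symmetric]) (force simp: image_iff)
  with one_closed have mem: "\<Delta> \<in> \<B>" unfolding \<B>_eq by blast
  obtain x y where xy: "x \<in> \<Delta>" "y \<in> \<Delta>" "x \<noteq> y" using \<Delta> by (auto simp: is_block_def)
  obtain z where z: "z \<in> E" "z \<notin> \<Delta>" using sub by auto
  have blocks: "block_at \<B> x = \<Delta>" "block_at \<B> y = \<Delta>"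
    using block_at_eq[OF \<B> mem] xy by auto
  have "x \<in> E" "y \<in> E" using xy sub by auto
  with xy(3) blocks show "\<not> inj_on (block_at \<B>) E" by (metis inj_onD)
  have "block_at \<B> z \<noteq> block_at \<B> x" using blocks z block_at_mem(2)[OF \<B> z(1)] by metis
  with z \<open>x \<in> E\<close> show "\<not> (\<forall>x\<in>E. \<forall>y\<in>E. block_at \<B> x = block_at \<B> y)" by metis
qed

section \<open>Simplicity\<close>

context regular_q_cycle_set
begin

lemma orbit_perm_group_apply:
  assumes g: "g \<in> carrier PG" and y: "y \<in> X"
  shows "orbit PG id (g y) = orbit PG id y"
proof -
  interpret group_action PG X id by (rule group_action_perm_group)
  have gy: "g y \<in> X" using Bij_apply_in[OF perm_group_in_Bij[OF g] y] .
  have mem: "g y \<in> orbit PG id y" using g by (auto simp: orbit_def)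
  have "g y \<in> orbit PG id (g y)" by (rule orbit_refl[OF gy])
  then show ?thesis
    using disjoint_union[of "orbit PG id (g y)" "orbit PG id y"] mem gy y
    by (auto simp: orbits_def)
qed

text \<open>The orbit of \<open>x \<cdot> y\<close> is the orbit of \<open>y\<close>, whatever \<open>x\<close> is; so the quotient by the orbits
  has the second projection for both operations.\<close>

lemma orbit_congruence_map: "congruence_map X (\<cdot>) (\<Ztypecolon>) (orbit PG id)"
proof -
  have "orbit PG id (x \<cdot> y) = orbit PG id y" "orbit PG id (x \<Ztypecolon> y) = orbit PG id y"
    if "x \<in> X" "y \<in> X" for x y
    using orbit_perm_group_apply[OF ltrans_in_perm_group(1)[OF that(1)] that(2)]
      orbit_perm_group_apply[OF ltrans_in_perm_group(2)[OF that(1)] that(2)] that(2)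
    by (simp_all add: ltrans_def)
  then show ?thesis by (simp add: congruence_map_def)
qed

text \<open>The orbit map has to be injective or constant, and it is not injective: trivial orbits make
  both operations the second projection, so every map on \<open>X\<close> is a quotient map, among them the one
  that only tells a single point from all others.  As \<open>X\<close> has more than one element, that map is not
  constant; by simplicity it is injective, which leaves room for just two elements.\<close>

lemma simple_imp_transitive:
  assumes simple: "simple_q_cycle_set X (\<cdot>) (\<Ztypecolon>)"
    and not2: "\<not> two_element_projection X (\<cdot>) (\<Ztypecolon>)"
  shows "acts_transitively X (\<cdot>) (\<Ztypecolon>)"
proof -
  interpret group_action PG X id by (rule group_action_perm_group)
  have card: "card X > 1" using simple by (simp add: simple_q_cycle_set_def)
  have "\<not> inj_on (orbit PG id) X"
  proof
    assume inj: "inj_on (orbit PG id) X"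
    have fixed: "g y = y" if g: "g \<in> carrier PG" and y: "y \<in> X" for g y
      using inj_onD[OF inj orbit_perm_group_apply[OF g y]
          Bij_apply_in[OF perm_group_in_Bij[OF g] y] y] .
    have triv: "x \<cdot> y = y" "x \<Ztypecolon> y = y" if "x \<in> X" "y \<in> X" for x y
      using fixed[OF ltrans_in_perm_group(1)[OF that(1)] that(2)]
        fixed[OF ltrans_in_perm_group(2)[OF that(1)] that(2)] that(2) by (simp_all add: ltrans_def)
    obtain a where a: "a \<in> X" using nonempty by auto
    have "congruence_map X (\<cdot>) (\<Ztypecolon>) (\<lambda>x. x = a)"
      using triv by (simp add: congruence_map_def)
    then have or: "inj_on (\<lambda>x. x = a) X \<or> (\<forall>x\<in>X. \<forall>y\<in>X. (x = a) = (y = a))"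
      by (rule simple_congruence_map_trivial[OF simple])
    have "X \<noteq> {a}" using card by auto
    then obtain b where b: "b \<in> X" "b \<noteq> a" using a by blast
    with or a have "inj_on (\<lambda>x. x = a) X" by blast
    then have "X = {a, b}" using a b by (auto simp: inj_on_def)
    then have "card X = 2" using b by auto
    then show False using not2 triv by (simp add: two_element_projection_def)
  qed
  then have const: "\<forall>x\<in>X. \<forall>y\<in>X. orbit PG id x = orbit PG id y"
    using simple_congruence_map_trivial[OF simple orbit_congruence_map] by blast
  show ?thesis
  proof
    fix x y assume "x \<in> X" "y \<in> X"
    then have "y \<in> orbit PG id x" using const orbit_refl by blast
    then show "\<exists>g\<in>carrier PG. id g x = y" by (auto simp: orbit_def)
  qed
qed

text \<open>The converse of \<open>Dis_fixes_fibres\<close> for blocks.  The block of \<open>x \<cdot> y\<close> depends only on the block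
  of \<open>y\<close> because \<open>\<sigma>\<^sub>x\<close> permutes the blocks; it depends only on the block of \<open>x\<close> because, for \<open>z\<close> in
  that block, \<open>\<sigma>\<^sub>x\<inverse>\<sigma>\<^sub>z\<close> lies in \<open>Dis\<close> and therefore maps each block to itself.\<close>

lemma block_at_congruence_map:
  assumes trans: "acts_transitively X (\<cdot>) (\<Ztypecolon>)" and \<B>: "blocks_system PG X id \<B>"
    and Dis: "\<And>u. u \<in> X \<Longrightarrow> Dis X (\<cdot>) (\<Ztypecolon>) (block_at \<B> u) \<subseteq> Fix PG id \<B>"
  shows "congruence_map X (\<cdot>) (\<Ztypecolon>) (block_at \<B>)"
proof -
  interpret transitive_action PG X id by (rule trans)
  have equiv: "block_at \<B> (g y) = g ` block_at \<B> y" if "g \<in> carrier PG" "y \<in> X" for g y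
    using block_at_equivariant[OF \<B> that] by simp
  have inv_mult: "block_at \<B> (h y) = block_at \<B> (g y)"
    if g: "g \<in> carrier PG" and h: "h \<in> carrier PG" and y: "y \<in> X"
      and Fix: "inv\<^bsub>BijGroup X\<^esub> g \<otimes>\<^bsub>BijGroup X\<^esub> h \<in> Fix PG id \<B>" for g h y
  proof -
    let ?k = "inv\<^bsub>BijGroup X\<^esub> g \<otimes>\<^bsub>BijGroup X\<^esub> h"
    have B: "g \<in> Bij X" "h \<in> Bij X" using g h perm_group_in_Bij by auto
    have k: "?k \<in> carrier PG" "?k ` block_at \<B> y = block_at \<B> y"
      using Fix block_at_mem(1)[OF \<B> y] by (auto simp: Fix_def stabilizer_def)
    have "g (?k y) = h y"
      using y B by (simp add: BijGroup_mult_apply BijGroup_inv_in_Bij BijGroup_apply_inv Bij_apply_in)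
    then have "block_at \<B> (h y) = g ` block_at \<B> (?k y)"
      using equiv[OF g] Bij_apply_in[OF perm_group_in_Bij[OF k(1)] y] by metis
    also have "\<dots> = block_at \<B> (g y)" using equiv k g y by simp
    finally show ?thesis .
  qed
  show ?thesis
    unfolding congruence_map_def
  proof (intro ballI impI)
    fix x x' y y'
    assume mem: "x \<in> X" "x' \<in> X" "y \<in> X" "y' \<in> X"
      and eq: "block_at \<B> x = block_at \<B> x'" "block_at \<B> y = block_at \<B> y'"
    have xx': "x \<in> block_at \<B> x" "x' \<in> block_at \<B> x" using block_at_mem(2)[OF \<B>] mem eq by auto
    have translate: "block_at \<B> (g y) = block_at \<B> (h y')"
      if "g \<in> carrier PG" "h \<in> carrier PG"
        "inv\<^bsub>BijGroup X\<^esub> g \<otimes>\<^bsub>BijGroup X\<^esub> h \<in> Dis X (\<cdot>) (\<Ztypecolon>) (block_at \<B> x)" for g h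
      using inv_mult[OF that(1,2) mem(4)] that(3) Dis[OF mem(1)] equiv[OF that(1)] mem eq by auto
    have Dis_mem:
      "inv\<^bsub>BijGroup X\<^esub> (ltrans X (\<cdot>) x) \<otimes>\<^bsub>BijGroup X\<^esub> ltrans X (\<cdot>) x'
        \<in> Dis X (\<cdot>) (\<Ztypecolon>) (block_at \<B> x)"
      "inv\<^bsub>BijGroup X\<^esub> (ltrans X (\<Ztypecolon>) x) \<otimes>\<^bsub>BijGroup X\<^esub> ltrans X (\<Ztypecolon>) x'
        \<in> Dis X (\<cdot>) (\<Ztypecolon>) (block_at \<B> x)"
      unfolding Dis_def by (rule generate.incl, use xx' in blast)+
    have "block_at \<B> (ltrans X (\<cdot>) x y) = block_at \<B> (ltrans X (\<cdot>) x' y')"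
      "block_at \<B> (ltrans X (\<Ztypecolon>) x y) = block_at \<B> (ltrans X (\<Ztypecolon>) x' y')"
      by (rule translate[OF ltrans_in_perm_group(1)[OF mem(1)] ltrans_in_perm_group(1)[OF mem(2)] Dis_mem(1)],
          rule translate[OF ltrans_in_perm_group(2)[OF mem(1)] ltrans_in_perm_group(2)[OF mem(2)] Dis_mem(2)])
    then show "block_at \<B> (x \<cdot> y) = block_at \<B> (x' \<cdot> y') \<and>
        block_at \<B> (x \<Ztypecolon> y) = block_at \<B> (x' \<Ztypecolon> y')"
      using mem by (simp add: ltrans_def)
  qed
qed

text \<open>Conversely, the fibres of a non-trivial quotient map form a blocks system that violates
  the criterion.  The block is any fibre with at least two elements; its translates are fibres, and
  by transitivity they cover \<open>X\<close>.\<close>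

lemma congruence_map_blocks_system:
  assumes fin: "finite X" and trans: "acts_transitively X (\<cdot>) (\<Ztypecolon>)"
    and f: "congruence_map X (\<cdot>) (\<Ztypecolon>) f"
    and not_inj: "\<not> inj_on f X" and not_const: "\<not> (\<forall>x\<in>X. \<forall>y\<in>X. f x = f y)"
  obtains \<B> where "blocks_system PG X id \<B>"
    and "\<And>u. u \<in> X \<Longrightarrow> Dis X (\<cdot>) (\<Ztypecolon>) (block_at \<B> u) \<subseteq> Fix PG id \<B>"
proof -
  interpret transitive_action PG X id by (rule trans)
  define fib where "fib x = {y \<in> X. f y = f x}" for x
  have image_fib: "g ` fib x = fib (g x)" if "g \<in> permutes_fibres X f" "x \<in> X" for g x
  proof -
    have gB: "g \<in> Bij X" using that by (simp add: permutes_fibres_def)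
    have iff: "f (g y) = f (g x) \<longleftrightarrow> f y = f x" if "y \<in> X" for y
      using \<open>g \<in> permutes_fibres X f\<close> \<open>x \<in> X\<close> that by (simp add: permutes_fibres_def)
    have "g ` X = X" using gB by (simp add: Bij_def bij_betw_def)
    then show ?thesis
      unfolding fib_def using iff by (auto simp: set_eq_iff image_iff) metis
  qed
  have pf: "g \<in> permutes_fibres X f" if "g \<in> carrier PG" for g
    using perm_group_permutes_fibres[OF fin f] that by auto
  obtain a b where ab: "a \<in> X" "b \<in> X" "a \<noteq> b" "f a = f b"
    using not_inj by (auto simp: inj_on_def)
  define \<B> where "\<B> = {id g ` fib a | g. g \<in> carrier PG}"
  have "is_block PG X id (fib a)"
    unfolding is_block_def
  proof (intro conjI ballI)
    have "fib a \<noteq> X"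
    proof
      assume "fib a = X"
      then have "f x = f a" if "x \<in> X" for x using that by (auto simp: fib_def)
      then show False using not_const by simp
    qed
    then show "fib a \<subset> X" by (auto simp: fib_def)
    show "\<exists>x\<in>fib a. \<exists>y\<in>fib a. x \<noteq> y" using ab by (auto simp: fib_def)
    show "id g ` fib a = fib a \<or> id g ` fib a \<inter> fib a = {}" if "g \<in> carrier PG" for g
      unfolding id_apply image_fib[OF pf[OF that] ab(1)]
      by (cases "f (g a) = f a") (auto simp: fib_def)
  qed
  then have \<B>: "blocks_system PG X id \<B>" unfolding blocks_system_def \<B>_def by blast
  have fib_\<B>: "\<exists>x\<in>X. S = fib x" if S: "S \<in> \<B>" for S
  proof -
    obtain g where g: "g \<in> carrier PG" "S = g ` fib a" using S unfolding \<B>_def by auto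
    then have "S = fib (g a)" using image_fib[OF pf ab(1)] by simp
    with Bij_apply_in[OF perm_group_in_Bij[OF g(1)] ab(1)] show ?thesis by blast
  qed
  have "Dis X (\<cdot>) (\<Ztypecolon>) (block_at \<B> u) \<subseteq> Fix PG id \<B>" if u: "u \<in> X" for u
  proof
    fix g assume g: "g \<in> Dis X (\<cdot>) (\<Ztypecolon>) (block_at \<B> u)"
    obtain v where v: "v \<in> X" "block_at \<B> u = fib v"
      using fib_\<B>[OF block_at_mem(1)[OF \<B> u]] by auto
    have PG: "g \<in> carrier PG"
      using g Dis_subset_perm_group[OF block_at_subset[OF \<B> u]] by auto
    have "Dis X (\<cdot>) (\<Ztypecolon>) (fib v) \<subseteq> fixes_fibres X f"
      by (rule Dis_fixes_fibres[OF fin f]) (auto simp: fib_def)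
    then have "g \<in> fixes_fibres X f" using g v(2) by auto
    then have "f (g x) = f x" if "x \<in> X" for x using that by (rule fixes_fibresD)
    then have fixed: "fib (g x) = fib x" if "x \<in> X" for x
      unfolding fib_def by (simp only: that)
    have "g ` S = S" if S: "S \<in> \<B>" for S
    proof -
      obtain x where x: "x \<in> X" "S = fib x" using fib_\<B>[OF S] by blast
      then show ?thesis using image_fib[OF pf[OF PG] x(1)] fixed[OF x(1)] by simp
    qed
    then show "g \<in> Fix PG id \<B>"
      using PG by (simp add: Fix_def stabilizer_def)
  qed
  with \<B> show thesis by (rule that)
qed

end

theorem theorem3p4:
  fixes X :: "'a set" and dot col :: "'a \<Rightarrow> 'a \<Rightarrow> 'a"
  assumes "regular_q_cycle_set X dot col" and "finite X" and "card X > 1"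
    and "\<not> two_element_projection X dot col"
  shows "simple_q_cycle_set X dot col \<longleftrightarrow>
    acts_transitively X dot col \<and>
    (\<forall>\<B>. blocks_system (perm_group X dot col) X id \<B> \<longrightarrow>
      (\<exists>u\<in>X. \<not> Dis X dot col (block_at \<B> u) \<subseteq> Fix (perm_group X dot col) id \<B>))"
    (is "?simple \<longleftrightarrow> ?trans \<and> ?blocks")
proof -
  interpret regular_q_cycle_set X dot col by (rule assms(1))
  show ?thesis
  proof
    assume simple: ?simple
    then have trans: ?trans using simple_imp_transitive assms(4) by blast
    interpret transitive_action "perm_group X dot col" X id by (rule trans)
    have ?blocks
      using simple_congruence_map_trivial[OF simple] block_at_congruence_map[OF trans]
        block_at_nontrivial by meson
    with trans show "?trans \<and> ?blocks" ..
  next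
    assume R: "?trans \<and> ?blocks"
    show ?simple
      unfolding simple_q_cycle_set_def
    proof (intro conjI allI impI)
      fix Y :: "'a set" and dot' col' f
      assume Y: "q_cycle_set Y dot' col' \<and> q_cycle_epi X dot col Y dot' col' f"
      then have f: "congruence_map X dot col f"
        by (blast intro: q_cycle_epi_congruence_map)
      have fX: "f ` X = Y" using Y by (simp add: q_cycle_epi_def)
      have "inj_on f X \<or> (\<forall>x\<in>X. \<forall>y\<in>X. f x = f y)"
        using congruence_map_blocks_system[OF assms(2) _ f] R by metis
      then show "bij_betw f X Y \<or> card Y = 1"
      proof
        assume "\<forall>x\<in>X. \<forall>y\<in>X. f x = f y"
        then have "f ` X = {f (SOME x. x \<in> X)}" using nonempty some_in_eq[of X] by blast
        then show ?thesis using fX by simp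
      qed (use fX in \<open>simp add: bij_betw_def\<close>)
    qed (use assms in auto)
  qed
qed

end
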